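(* Let $\mathbb V = (\mathbb F(\mathbb V), \{{\bf z}_t\}_{t \in \mathbb T})$ be a positive space. Then the global monomials on $\mathbb V$ (i.e. the distinct elements of the set $\mathcal U^{\rm mono}(\mathbb V)$) are linearly independent over $\mathbb Z$.
   Context: For free generators ${\bf z}=(z_1,\ldots,z_r)$ of a rational function field over $\mathbb Q$, $\mathbb Q_{\rm sf}({\bf z})=\{F/H \mid 0\neq F,H\in\mathbb Z_{\geq 0}[z_1,\ldots,z_r]\}$. A positive space of dimension $r$ is a pair $\mathbb V=(\mathbb F,\{{\bf z}_t\}_{t\in\mathbb T})$, where $\mathbb F=\mathbb F(\mathbb V)$ is the field of rational functions in $r$ variables over $\mathbb Q$, $\mathbb T$ is a non-empty index set, and each ${\bf z}_t=(z_{1;t},\ldots,z_{r;t})$ is an ordered set of free generators of $\mathbb F$ over $\mathbb Q$, such that $\mathbb Q_{\rm sf}({\bf z}_t)=\mathbb Q_{\rm sf}({\bf z}_{t'})\subseteq\mathbb F$ for all $t,t'\in\mathbb T$. Each ${\bf z}_t$ is called a chart. The coordinate algebra is $\mathcal U(\mathbb V)=\bigcap_{t\in\mathbb T}\mathbb Z[z_{1;t}^{\pm1},\ldots,z_{r;t}^{\pm1}]$. A global monomial on $\mathbb V$ is an element of $\mathcal U(\mathbb V)$ of the form ${\bf z}_t^{\bf h}=z_{1;t}^{h_1}\cdots z_{r;t}^{h_r}$ for some $t\in\mathbb T$, ${\bf h}\in\mathbb Z^r$. The set of global monomials is $\mathcal U^{\rm mono}(\mathbb V)=\bigcup_{t\in\mathbb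 T}\{{\bf z}_t^{\bf h}\mid {\bf h}\in\mathbb Z^r,\ {\bf z}_t^{\bf h}\in\mathcal U(\mathbb V)\}$. *)

theory Defs
  imports Complex_Main "HOL-Library.Poly_Mapping"
begin

text \<open>
  The ambient field is the type \<open>'f\<close>; tuples \<open>(z\<^sub>1, \<dots>, z\<^sub>r)\<close> in it are functions
  \<open>z :: nat \<Rightarrow> 'f\<close>, of which only the values at \<open>i < r\<close> matter. Polynomials and Laurent
  polynomials in \<open>r\<close> variables are finitely supported coefficient families indexed by finitely
  supported exponent vectors whose support lies in \<open>{..<r}\<close>.
\<close>

definition exponents :: "nat \<Rightarrow> (nat \<Rightarrow>\<^sub>0 'e::zero) set" where
  "exponents r = {h. Poly_Mapping.keys h \<subseteq> {..<r}}"

definition polys :: "nat \<Rightarrow> ((nat \<Rightarrow>\<^sub>0 nat) \<Rightarrow>\<^sub>0 rat) set" where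
  "polys r = {p. Poly_Mapping.keys p \<subseteq> exponents r}"

definition poly_eval :: "nat \<Rightarrow> (nat \<Rightarrow> 'f) \<Rightarrow> ((nat \<Rightarrow>\<^sub>0 nat) \<Rightarrow>\<^sub>0 rat) \<Rightarrow> 'f::field_char_0" where
  "poly_eval r z p = (\<Sum>m\<in>Poly_Mapping.keys p.
     of_rat (Poly_Mapping.lookup p m) * (\<Prod>i<r. z i ^ Poly_Mapping.lookup m i))"

definition algebraically_independent :: "nat \<Rightarrow> (nat \<Rightarrow> 'f::field_char_0) \<Rightarrow> bool" where
  "algebraically_independent r z \<longleftrightarrow> (\<forall>p\<in>polys r. poly_eval r z p = 0 \<longrightarrow> p = 0)"

text \<open>
  The existence of free generators expresses that \<open>'f\<close> is a field of rational
  functions in \<open>r\<close> variables over the rational numbers, and that \<open>z\<close> is a choice of variables.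
\<close>

definition free_generators :: "nat \<Rightarrow> (nat \<Rightarrow> 'f::field_char_0) \<Rightarrow> bool" where
  "free_generators r z \<longleftrightarrow> algebraically_independent r z \<and>
     (\<forall>x. \<exists>p\<in>polys r. \<exists>q\<in>polys r. poly_eval r z q \<noteq> 0 \<and> x = poly_eval r z p / poly_eval r z q)"

text \<open>The subset \<open>\<int>\<^sub>\<ge>\<^sub>0[z\<^sub>1, \<dots>, z\<^sub>r]\<close> of the ambient field.\<close>

definition nonneg_polys :: "nat \<Rightarrow> (nat \<Rightarrow> 'f::field_char_0) \<Rightarrow> 'f set" where
  "nonneg_polys r z = {poly_eval r z p | p. p \<in> polys r \<and> (\<forall>m. Poly_Mapping.lookup p m \<in> \<nat>)}"

definition subtraction_free :: "nat \<Rightarrow> (nat \<Rightarrow> 'f::field_char_0) \<Rightarrow> 'f set" where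
  "subtraction_free r z =
     {F / H | F H. F \<in> nonneg_polys r z \<and> H \<in> nonneg_polys r z \<and> F \<noteq> 0 \<and> H \<noteq> 0}"

definition positive_space :: "nat \<Rightarrow> 't set \<Rightarrow> ('t \<Rightarrow> nat \<Rightarrow> 'f::field_char_0) \<Rightarrow> bool" where
  "positive_space r T z \<longleftrightarrow> T \<noteq> {} \<and> (\<forall>t\<in>T. free_generators r (z t)) \<and>
     (\<forall>t\<in>T. \<forall>t'\<in>T. subtraction_free r (z t) = subtraction_free r (z t'))"

definition laurent_monomial :: "nat \<Rightarrow> (nat \<Rightarrow> 'f) \<Rightarrow> (nat \<Rightarrow>\<^sub>0 int) \<Rightarrow> 'f::field_char_0" where
  "laurent_monomial r z h = (\<Prod>i<r. z i powi Poly_Mapping.lookup h i)"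

text \<open>The subring \<open>\<int>[z\<^sub>1\<^sup>\<plusminus>\<^sup>1, \<dots>, z\<^sub>r\<^sup>\<plusminus>\<^sup>1]\<close> of the ambient field.\<close>

definition laurent_ring :: "nat \<Rightarrow> (nat \<Rightarrow> 'f::field_char_0) \<Rightarrow> 'f set" where
  "laurent_ring r z =
     {\<Sum>h\<in>Poly_Mapping.keys p. of_int (Poly_Mapping.lookup p h) * laurent_monomial r z h
       | p :: (nat \<Rightarrow>\<^sub>0 int) \<Rightarrow>\<^sub>0 int. Poly_Mapping.keys p \<subseteq> exponents r}"

definition coordinate_algebra :: "nat \<Rightarrow> 't set \<Rightarrow> ('t \<Rightarrow> nat \<Rightarrow> 'f::field_char_0) \<Rightarrow> 'f set" where
  "coordinate_algebra r T z = (\<Inter>t\<in>T. laurent_ring r (z t))"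

definition global_monomials :: "nat \<Rightarrow> 't set \<Rightarrow> ('t \<Rightarrow> nat \<Rightarrow> 'f::field_char_0) \<Rightarrow> 'f set" where
  "global_monomials r T z =
     (\<Union>t\<in>T. {laurent_monomial r (z t) h | h.
        h \<in> exponents r \<and> laurent_monomial r (z t) h \<in> coordinate_algebra r T z})"

definition int_scale :: "int \<Rightarrow> 'f::field_char_0 \<Rightarrow> 'f" where
  "int_scale c x = of_int c * x"

lemma module_int_scale: "module int_scale"
  by unfold_locales (simp_all add: int_scale_def algebra_simps)

end

(* A tropical point is a map from the common semifield of subtraction-free expressions to the
   integers that turns products into sums and sums into minima; the notion does not depend on a
   chart. If F is subtraction-free and Laurent in a chart, then F has at every tropical point a value
   at most that of each Laurent monomial in its support. Lowest weights define enough tropical points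
   to show that global monomials with the same values coincide. In a linear relation choose
   a global monomial whose tropical values are minimal for the pointwise order and expand all terms
   in a chart where it is a monomial: it occurs in no other expansion, so its coefficient is zero. *)
theory Submission
  imports Defs
begin

section \<open>Products of finitely supported families and their lowest weights\<close>

lemma poly_mapping_sum_singles:
  "(\<Sum>k\<in>Poly_Mapping.keys p. Poly_Mapping.single k (Poly_Mapping.lookup p k)) = p"
proof (rule poly_mapping_eqI)
  fix k
  have "Poly_Mapping.lookup (\<Sum>k\<in>Poly_Mapping.keys p. Poly_Mapping.single k (Poly_Mapping.lookup p k)) k
      = (\<Sum>l\<in>Poly_Mapping.keys p. if l = k then Poly_Mapping.lookup p l else 0)"
    by (simp add: lookup_sum lookup_single when_def)
  also have "\<dots> = Poly_Mapping.lookup p k"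
    by (simp add: sum.delta in_keys_iff)
  finally show "Poly_Mapping.lookup (\<Sum>k\<in>Poly_Mapping.keys p.
      Poly_Mapping.single k (Poly_Mapping.lookup p k)) k = Poly_Mapping.lookup p k" .
qed

lemma times_poly_mapping_eq_sum:
  "p * q = (\<Sum>k\<in>Poly_Mapping.keys p. \<Sum>l\<in>Poly_Mapping.keys q.
     Poly_Mapping.single (k + l) (Poly_Mapping.lookup p k * Poly_Mapping.lookup q l))"
proof -
  have "p * q = (\<Sum>k\<in>Poly_Mapping.keys p. Poly_Mapping.single k (Poly_Mapping.lookup p k)) *
      (\<Sum>l\<in>Poly_Mapping.keys q. Poly_Mapping.single l (Poly_Mapping.lookup q l))"
    by (simp only: poly_mapping_sum_singles)
  then show ?thesis
    by (simp add: sum_product mult_single)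
qed

text \<open>The order of \<open>p\<close> along \<open>w\<close>, as in a monomial valuation. At
  \<open>p = 0\<close> this is \<open>Min {}\<close>, so the facts below assume
  \<open>p \<noteq> 0\<close> or start from a key.\<close>

definition lowest :: "('a \<Rightarrow> int) \<Rightarrow> ('a \<Rightarrow>\<^sub>0 'b::zero) \<Rightarrow> int" where
  "lowest w p = Min (w ` Poly_Mapping.keys p)"

lemma lowest_le: "k \<in> Poly_Mapping.keys p \<Longrightarrow> lowest w p \<le> w k"
  by (simp add: lowest_def)

lemma lowest_attained:
  assumes "p \<noteq> 0"
  obtains k where "k \<in> Poly_Mapping.keys p" "w k = lowest w p"
proof -
  have "lowest w p \<in> w ` Poly_Mapping.keys p"
    unfolding lowest_def by (rule Min_in) (auto simp: assms)
  then show ?thesis using that by auto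
qed

lemma lowest_eqI:
  "k \<in> Poly_Mapping.keys p \<Longrightarrow> (\<And>l. l \<in> Poly_Mapping.keys p \<Longrightarrow> w k \<le> w l) \<Longrightarrow> lowest w p = w k"
  unfolding lowest_def by (rule Min_eqI) auto

text \<open>Ties between terms of the same weight are broken by the total order on exponents, so that
  no cancellation can occur in the chosen coefficient of the product.\<close>

lemma lowest_term_mult:
  fixes p q :: "'a::{ordered_cancel_comm_monoid_add, linorder} \<Rightarrow>\<^sub>0 'b::semiring_no_zero_divisors"
  assumes w: "\<And>a b. w (a + b) = w a + w b" and "p \<noteq> 0" "q \<noteq> 0"
  obtains a b where "a \<in> Poly_Mapping.keys p" "w a = lowest w p"
    "b \<in> Poly_Mapping.keys q" "w b = lowest w q" "a + b \<in> Poly_Mapping.keys (p * q)"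
proof -
  let ?A = "{k \<in> Poly_Mapping.keys p. w k = lowest w p}"
  let ?B = "{k \<in> Poly_Mapping.keys q. w k = lowest w q}"
  have ne: "?A \<noteq> {}" "?B \<noteq> {}"
    by (auto intro: lowest_attained[OF assms(2), of w] lowest_attained[OF assms(3), of w])
  define a b where "a = Min ?A" and "b = Min ?B"
  have a: "a \<in> ?A" and b: "b \<in> ?B"
    unfolding a_def b_def using ne by (auto intro!: Min_in simp del: mem_Collect_eq)
  \<comment> \<open>Equal sums have equal total weight, and neither summand can fall below its
    lowest weight, so both \<open>k\<close> and \<open>l\<close> are of lowest weight. Strict
    monotonicity of addition then rules out every pair other than \<open>(a, b)\<close>.\<close>
  have eq: "k = a \<and> l = b"
    if kl: "k \<in> Poly_Mapping.keys p" "l \<in> Poly_Mapping.keys q" "k + l = a + b" for k l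
  proof -
    have "w k + w l = w a + w b"
      using w kl(3) by metis
    moreover have "w a \<le> w k" "w b \<le> w l"
      using a b kl lowest_le by auto
    ultimately have "k \<in> ?A" "l \<in> ?B"
      using a b kl by auto
    then have "a \<le> k" "b \<le> l"
      unfolding a_def b_def by auto
    then show ?thesis
      using kl(3) by (metis add_less_le_mono add_le_less_mono less_irrefl order_le_less)
  qed
  have "Poly_Mapping.lookup (p * q) (a + b) =
      (\<Sum>k\<in>Poly_Mapping.keys p. \<Sum>l\<in>Poly_Mapping.keys q.
        Poly_Mapping.lookup p k * Poly_Mapping.lookup q l when k + l = a + b)"
    by (simp add: times_poly_mapping_eq_sum lookup_sum lookup_single)
  also have "\<dots> = (\<Sum>k\<in>Poly_Mapping.keys p. \<Sum>l\<in>Poly_Mapping.keys q.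
        if k = a then if l = b then Poly_Mapping.lookup p a * Poly_Mapping.lookup q b else 0 else 0)"
    by (intro sum.cong refl) (use eq in \<open>auto simp: when_def\<close>)
  also have "\<dots> = (\<Sum>k\<in>Poly_Mapping.keys p.
        if k = a then Poly_Mapping.lookup p a * Poly_Mapping.lookup q b else 0)"
    by (intro sum.cong refl) (use b in \<open>auto simp: sum.delta\<close>)
  also have "\<dots> = Poly_Mapping.lookup p a * Poly_Mapping.lookup q b"
    using a by simp
  also have "\<dots> \<noteq> 0"
    using a b by (auto simp: in_keys_iff)
  finally have "a + b \<in> Poly_Mapping.keys (p * q)"
    by (simp add: in_keys_iff)
  then show ?thesis
    using that a b by blast
qed

text \<open>Every key of the product is a sum of keys, which gives the lower bound; the uncancelled
  term from \<open>lowest_term_mult\<close> attains it. Coefficients of either sign are allowed,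
  which matters for Laurent expansions of global monomials.\<close>

lemma lowest_mult:
  fixes p q :: "'a::{ordered_cancel_comm_monoid_add, linorder} \<Rightarrow>\<^sub>0 'b::semiring_no_zero_divisors"
  assumes w: "\<And>a b. w (a + b) = w a + w b" and "p \<noteq> 0" "q \<noteq> 0"
  shows "lowest w (p * q) = lowest w p + lowest w q"
proof -
  obtain a b where ab: "a \<in> Poly_Mapping.keys p" "w a = lowest w p"
    "b \<in> Poly_Mapping.keys q" "w b = lowest w q" "a + b \<in> Poly_Mapping.keys (p * q)"
    using lowest_term_mult[of w p q] assms by metis
  have "lowest w (p * q) = w (a + b)"
  proof (rule lowest_eqI[OF ab(5)])
    fix l assume "l \<in> Poly_Mapping.keys (p * q)"
    then obtain c d where "l = c + d" "c \<in> Poly_Mapping.keys p" "d \<in> Poly_Mapping.keys q"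
      using keys_mult by blast
    then show "w (a + b) \<le> w l"
      using ab lowest_le by (metis w add_mono)
  qed
  then show ?thesis
    using ab w by simp
qed

section \<open>Transport of exponents along injective maps\<close>

definition push_keys :: "('a \<Rightarrow> 'c) \<Rightarrow> ('a \<Rightarrow>\<^sub>0 'b::comm_monoid_add) \<Rightarrow> 'c \<Rightarrow>\<^sub>0 'b" where
  "push_keys f p = (\<Sum>k\<in>Poly_Mapping.keys p. Poly_Mapping.single (f k) (Poly_Mapping.lookup p k))"

lemma lookup_push_keys:
  assumes "inj_on f (Poly_Mapping.keys p)"
  shows "Poly_Mapping.lookup (push_keys f p) l =
    (if l \<in> f ` Poly_Mapping.keys p then Poly_Mapping.lookup p (inv_into (Poly_Mapping.keys p) f l) else 0)"
proof (cases "l \<in> f ` Poly_Mapping.keys p")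
  case True
  then obtain k where k: "k \<in> Poly_Mapping.keys p" "l = f k"
    by auto
  have "Poly_Mapping.lookup (push_keys f p) l =
      (\<Sum>j\<in>Poly_Mapping.keys p. if j = k then Poly_Mapping.lookup p j else 0)"
    unfolding push_keys_def lookup_sum lookup_single
    by (intro sum.cong refl) (use k assms in \<open>auto simp: when_def dest: inj_onD\<close>)
  then show ?thesis
    using k assms by (simp add: sum.delta in_keys_iff)
next
  case False
  then show ?thesis
    by (auto simp: push_keys_def lookup_sum lookup_single when_def intro!: sum.neutral)
qed

lemma lookup_push_keys_image:
  "inj_on f (Poly_Mapping.keys p) \<Longrightarrow> k \<in> Poly_Mapping.keys p \<Longrightarrow>
    Poly_Mapping.lookup (push_keys f p) (f k) = Poly_Mapping.lookup p k"
  by (simp add: lookup_push_keys)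

lemma keys_push_keys:
  assumes "inj_on f (Poly_Mapping.keys p)"
  shows "Poly_Mapping.keys (push_keys f p) = f ` Poly_Mapping.keys p"
  using assms by (auto simp: in_keys_iff lookup_push_keys split: if_splits)

lemma push_keys_eq_0_iff:
  "inj_on f (Poly_Mapping.keys p) \<Longrightarrow> push_keys f p = 0 \<longleftrightarrow> p = 0"
  by (metis keys_push_keys keys_eq_empty image_is_empty)

section \<open>Laurent polynomials with rational coefficients and their evaluation\<close>

definition laurents :: "nat \<Rightarrow> ((nat \<Rightarrow>\<^sub>0 int) \<Rightarrow>\<^sub>0 rat) set" where
  "laurents r = {p. Poly_Mapping.keys p \<subseteq> exponents r}"

text \<open>Zero is excluded so that the elements can serve as numerators and denominators of
  subtraction-free expressions.\<close>

definition nonneg_laurents :: "nat \<Rightarrow> ((nat \<Rightarrow>\<^sub>0 int) \<Rightarrow>\<^sub>0 rat) set" where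
  "nonneg_laurents r = {p \<in> laurents r. p \<noteq> 0 \<and> (\<forall>h. Poly_Mapping.lookup p h \<in> \<nat>)}"

definition laurent_eval :: "nat \<Rightarrow> (nat \<Rightarrow> 'f) \<Rightarrow> ((nat \<Rightarrow>\<^sub>0 int) \<Rightarrow>\<^sub>0 rat) \<Rightarrow> 'f::field_char_0" where
  "laurent_eval r z p = (\<Sum>h\<in>Poly_Mapping.keys p.
     of_rat (Poly_Mapping.lookup p h) * laurent_monomial r z h)"

lemma exponents_add: "h \<in> exponents r \<Longrightarrow> k \<in> exponents r \<Longrightarrow> h + k \<in> exponents r"
  for h k :: "nat \<Rightarrow>\<^sub>0 'e::monoid_add"
  using keys_add[of h k] by (auto simp: exponents_def)

lemma exponents_lookup_eq_0: "h \<in> exponents r \<Longrightarrow> \<not> i < r \<Longrightarrow> Poly_Mapping.lookup h i = 0"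
  unfolding exponents_def by (metis in_keys_iff lessThan_iff mem_Collect_eq subsetD)

lemma laurents_add: "p \<in> laurents r \<Longrightarrow> q \<in> laurents r \<Longrightarrow> p + q \<in> laurents r"
  using keys_add[of p q] by (auto simp: laurents_def)

lemma laurents_sum: "(\<And>a. a \<in> A \<Longrightarrow> f a \<in> laurents r) \<Longrightarrow> sum f A \<in> laurents r"
  by (induction A rule: infinite_finite_induct) (simp_all add: laurents_add, simp_all add: laurents_def)

lemma laurents_mult: "p \<in> laurents r \<Longrightarrow> q \<in> laurents r \<Longrightarrow> p * q \<in> laurents r"
  using keys_mult[of p q] exponents_add unfolding laurents_def by blast

lemma laurents_single: "h \<in> exponents r \<Longrightarrow> Poly_Mapping.single h c \<in> laurents r"
  by (auto simp: laurents_def)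

lemma nonneg_laurents_single:
  "h \<in> exponents r \<Longrightarrow> Poly_Mapping.single h 1 \<in> nonneg_laurents r"
  by (auto simp: nonneg_laurents_def laurents_single lookup_single when_def poly_mapping_eq_iff fun_eq_iff)

text \<open>Nonnegative coefficients cannot cancel. This is why the lowest weight of such a sum is
  exactly a minimum and not merely bounded below by one.\<close>

lemma keys_add_nonneg:
  fixes p q :: "'a \<Rightarrow>\<^sub>0 rat"
  assumes "\<And>h. 0 \<le> Poly_Mapping.lookup p h" "\<And>h. 0 \<le> Poly_Mapping.lookup q h"
  shows "Poly_Mapping.keys (p + q) = Poly_Mapping.keys p \<union> Poly_Mapping.keys q"
proof -
  have "Poly_Mapping.lookup p h + Poly_Mapping.lookup q h = 0 \<longleftrightarrow>
    Poly_Mapping.lookup p h = 0 \<and> Poly_Mapping.lookup q h = 0" for h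
    using assms[of h] by linarith
  then show ?thesis
    unfolding set_eq_iff Un_iff in_keys_iff lookup_add by blast
qed

lemma keys_add_nonneg_laurents:
  assumes "p \<in> nonneg_laurents r" "q \<in> nonneg_laurents r"
  shows "Poly_Mapping.keys (p + q) = Poly_Mapping.keys p \<union> Poly_Mapping.keys q"
  by (intro keys_add_nonneg) (use assms in \<open>metis (mono_tags, lifting) Nats_cases
      mem_Collect_eq nonneg_laurents_def of_nat_0_le_iff\<close>)+

lemma nonneg_laurents_add:
  assumes "p \<in> nonneg_laurents r" "q \<in> nonneg_laurents r"
  shows "p + q \<in> nonneg_laurents r"
proof -
  have "p + q \<noteq> 0"
    using keys_add_nonneg_laurents[OF assms] assms
    by (metis (mono_tags, lifting) Un_empty keys_eq_empty mem_Collect_eq nonneg_laurents_def)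
  then show ?thesis
    using assms by (auto simp: nonneg_laurents_def laurents_add lookup_add)
qed

lemma sum_in_Nats: "(\<And>x. x \<in> A \<Longrightarrow> f x \<in> \<nat>) \<Longrightarrow> sum f A \<in> \<nat>"
  by (induction A rule: infinite_finite_induct) auto

lemma nonneg_laurents_mult:
  assumes "p \<in> nonneg_laurents r" "q \<in> nonneg_laurents r"
  shows "p * q \<in> nonneg_laurents r"
proof -
  have "Poly_Mapping.lookup (p * q) h \<in> \<nat>" for h
    unfolding times_poly_mapping_eq_sum lookup_sum lookup_single
    using assms by (auto simp: nonneg_laurents_def when_def intro!: sum_in_Nats)
  then show ?thesis
    using assms by (auto simp: nonneg_laurents_def laurents_mult)
qed

lemma laurent_eval_superset:
  assumes "finite A" "Poly_Mapping.keys p \<subseteq> A"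
  shows "laurent_eval r z p = (\<Sum>h\<in>A. of_rat (Poly_Mapping.lookup p h) * laurent_monomial r z h)"
  unfolding laurent_eval_def by (rule sum.mono_neutral_left) (use assms in \<open>auto simp: in_keys_iff\<close>)

lemma laurent_eval_0 [simp]: "laurent_eval r z 0 = 0"
  by (simp add: laurent_eval_def)

lemma laurent_eval_add: "laurent_eval r z (p + q) = laurent_eval r z p + laurent_eval r z q"
proof -
  let ?A = "Poly_Mapping.keys p \<union> Poly_Mapping.keys q"
  show ?thesis
    using keys_add[of p q]
    by (simp add: laurent_eval_superset[of ?A] lookup_add of_rat_add distrib_right sum.distrib)
qed

lemma laurent_eval_sum: "laurent_eval r z (sum f A) = (\<Sum>a\<in>A. laurent_eval r z (f a))"
  by (induction A rule: infinite_finite_induct) (simp_all add: laurent_eval_add)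

lemma laurent_eval_single:
  "laurent_eval r z (Poly_Mapping.single h c) = of_rat c * laurent_monomial r z h"
  by (simp add: laurent_eval_def)

lemma laurent_monomial_0 [simp]: "laurent_monomial r z 0 = 1"
  by (simp add: laurent_monomial_def)

lemma laurent_eval_1 [simp]: "laurent_eval r z 1 = 1"
  using laurent_eval_single[of r z 0 1] by simp

text \<open>Nonvanishing matters: at \<open>z i = 0\<close> the exponents 1 and -1 multiply to 0,
  whereas their sum gives 1.\<close>

lemma laurent_monomial_add:
  assumes "\<And>i. i < r \<Longrightarrow> z i \<noteq> 0"
  shows "laurent_monomial r z (h + k) = laurent_monomial r z h * laurent_monomial r z k"
  using assms by (simp add: laurent_monomial_def lookup_add power_int_add flip: prod.distrib)

lemma laurent_eval_mult:
  assumes "\<And>i. i < r \<Longrightarrow> z i \<noteq> 0"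
  shows "laurent_eval r z (p * q) = laurent_eval r z p * laurent_eval r z q"
  unfolding times_poly_mapping_eq_sum laurent_eval_sum laurent_eval_single
  by (simp add: laurent_eval_def sum_product laurent_monomial_add assms of_rat_mult algebra_simps)

lemma laurent_eval_push_keys:
  assumes "inj_on f (Poly_Mapping.keys p)"
  shows "laurent_eval r z (push_keys f p) =
    (\<Sum>k\<in>Poly_Mapping.keys p. of_rat (Poly_Mapping.lookup p k) * laurent_monomial r z (f k))"
  by (simp add: push_keys_def laurent_eval_sum laurent_eval_single)

section \<open>Passage between polynomials and Laurent polynomials\<close>

lemma lookup_map_int: "Poly_Mapping.lookup (Poly_Mapping.map int m) i = int (Poly_Mapping.lookup m i)"
  by (simp add: map.rep_eq when_def)

lemma keys_map_int: "Poly_Mapping.keys (Poly_Mapping.map int m) = Poly_Mapping.keys m"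
  unfolding set_eq_iff in_keys_iff lookup_map_int by simp

text \<open>The embedding of natural into integer exponents is injective, so coefficients are merely
  relabelled; vanishing and nonnegativity carry over.\<close>

lemma poly_eval_eq_laurent_eval:
  assumes "p \<in> polys r"
  obtains q where "q \<in> laurents r" "laurent_eval r z q = poly_eval r z p" "q = 0 \<longleftrightarrow> p = 0"
    "(\<forall>m. Poly_Mapping.lookup p m \<in> \<nat>) \<longrightarrow> (\<forall>h. Poly_Mapping.lookup q h \<in> \<nat>)"
proof
  let ?f = "Poly_Mapping.map int :: (nat \<Rightarrow>\<^sub>0 nat) \<Rightarrow> (nat \<Rightarrow>\<^sub>0 int)"
  have inj: "inj_on ?f (Poly_Mapping.keys p)"
    by (rule inj_onI) (metis lookup_map_int of_nat_eq_iff poly_mapping_eqI)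
  have "?f m \<in> exponents r" if "m \<in> Poly_Mapping.keys p" for m
    using that assms unfolding exponents_def polys_def mem_Collect_eq keys_map_int by blast
  then show "push_keys ?f p \<in> laurents r"
    by (auto simp: laurents_def keys_push_keys inj)
  show "laurent_eval r z (push_keys ?f p) = poly_eval r z p"
    by (simp add: laurent_eval_push_keys inj poly_eval_def laurent_monomial_def lookup_map_int)
  show "push_keys ?f p = 0 \<longleftrightarrow> p = 0"
    by (rule push_keys_eq_0_iff[OF inj])
  show "(\<forall>m. Poly_Mapping.lookup p m \<in> \<nat>) \<longrightarrow> (\<forall>h. Poly_Mapping.lookup (push_keys ?f p) h \<in> \<nat>)"
    by (simp add: lookup_push_keys inj)
qed

text \<open>Multiplication by a power of the product of all generators shifts every exponent
  upwards. The claim covers all large \<open>M\<close> so that a numerator and a denominator can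
  later be cleared by the same power.\<close>

lemma clear_denominators:
  assumes p: "p \<in> laurents r" and z: "\<And>i. i < r \<Longrightarrow> z i \<noteq> 0"
  shows "\<exists>N. \<forall>M\<ge>N. \<exists>q\<in>polys r.
    poly_eval r z q = (\<Prod>i<r. z i) ^ M * laurent_eval r z p \<and> (q = 0 \<longleftrightarrow> p = 0) \<and>
    ((\<forall>h. Poly_Mapping.lookup p h \<in> \<nat>) \<longrightarrow> (\<forall>m. Poly_Mapping.lookup q m \<in> \<nat>))"
proof (intro exI allI impI)
  let ?D = "(\<lambda>(h, i). nat (- Poly_Mapping.lookup h i)) ` (Poly_Mapping.keys p \<times> {..<r})"
  \<comment> \<open>The witness for \<open>N\<close> bounds all negative exponents; the inserted 0
    keeps \<open>Max\<close> on a nonempty set when \<open>p = 0\<close> or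
    \<open>r = 0\<close>.\<close>
  fix M assume M: "Max (insert 0 ?D) \<le> M"
  have bound: "0 \<le> Poly_Mapping.lookup h i + int M" if "h \<in> Poly_Mapping.keys p" "i < r" for h i
  proof -
    have "nat (- Poly_Mapping.lookup h i) \<in> insert 0 ?D"
      using that by force
    then have "nat (- Poly_Mapping.lookup h i) \<le> M"
      using M by (meson Max_ge finite_SigmaI finite_imageI finite_insert finite_keys
          finite_lessThan order_trans)
    then show ?thesis
      by linarith
  qed
  \<comment> \<open>The shift by \<open>M\<close> in each of the first \<open>r\<close> coordinates.
    By \<open>bound\<close>, \<open>nat\<close> truncates nothing on keys of \<open>p\<close>; the
    value 0 elsewhere keeps the support finite and inside \<open>{..<r}\<close>.\<close>
  define f :: "(nat \<Rightarrow>\<^sub>0 int) \<Rightarrow> (nat \<Rightarrow>\<^sub>0 nat)"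
    where "f h = Abs_poly_mapping (\<lambda>i. if i < r then nat (Poly_Mapping.lookup h i + int M) else 0)" for h
  have lookup_f: "Poly_Mapping.lookup (f h) i =
      (if i < r then nat (Poly_Mapping.lookup h i + int M) else 0)" for h i
    unfolding f_def by (subst lookup_Abs_poly_mapping) (auto intro: finite_subset[of _ "{..<r}"])
  have inj: "inj_on f (Poly_Mapping.keys p)"
  proof (rule inj_onI, rule poly_mapping_eqI)
    fix h k i
    assume h: "h \<in> Poly_Mapping.keys p" and k: "k \<in> Poly_Mapping.keys p" and "f h = f k"
    then have "Poly_Mapping.lookup (f h) i = Poly_Mapping.lookup (f k) i"
      by simp
    moreover have "Poly_Mapping.lookup h i = 0" "Poly_Mapping.lookup k i = 0" if "\<not> i < r"
      using h k p that exponents_lookup_eq_0 by (auto simp: laurents_def)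
    ultimately show "Poly_Mapping.lookup h i = Poly_Mapping.lookup k i"
      using bound[OF h, of i] bound[OF k, of i] by (cases "i < r") (simp_all add: lookup_f eq_nat_nat_iff)
  qed
  have monomial: "(\<Prod>i<r. z i ^ Poly_Mapping.lookup (f h) i) = (\<Prod>i<r. z i) ^ M * laurent_monomial r z h"
    if h: "h \<in> Poly_Mapping.keys p" for h
  proof -
    have "z i ^ Poly_Mapping.lookup (f h) i = z i ^ M * z i powi Poly_Mapping.lookup h i"
      if i: "i < r" for i
    proof -
      have "z i ^ Poly_Mapping.lookup (f h) i = z i powi int (Poly_Mapping.lookup (f h) i)"
        by (simp only: power_int_of_nat)
      also have "\<dots> = z i powi (int M + Poly_Mapping.lookup h i)"
        using bound[OF h i] i by (simp add: lookup_f add.commute)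
      finally show ?thesis
        using z[OF i] by (simp add: power_int_add)
    qed
    then show ?thesis
      by (simp add: laurent_monomial_def prod.distrib prod_power_distrib)
  qed
  have "f h \<in> exponents r" for h
    unfolding exponents_def subset_iff in_keys_iff lookup_f mem_Collect_eq by simp
  then have "push_keys f p \<in> polys r"
    unfolding polys_def mem_Collect_eq keys_push_keys[OF inj] by blast
  moreover have "poly_eval r z (push_keys f p) = (\<Prod>i<r. z i) ^ M * laurent_eval r z p"
    using inj
    by (simp add: poly_eval_def keys_push_keys sum.reindex lookup_push_keys_image monomial
        laurent_eval_def sum_distrib_left algebra_simps)
  ultimately show "\<exists>q\<in>polys r.
    poly_eval r z q = (\<Prod>i<r. z i) ^ M * laurent_eval r z p \<and> (q = 0 \<longleftrightarrow> p = 0) \<and>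
    ((\<forall>h. Poly_Mapping.lookup p h \<in> \<nat>) \<longrightarrow> (\<forall>m. Poly_Mapping.lookup q m \<in> \<nat>))"
    by (intro bexI[of _ "push_keys f p"]) (simp_all add: push_keys_eq_0_iff inj lookup_push_keys)
qed

section \<open>Weights, tropical points and monomial valuations\<close>

definition weight :: "nat \<Rightarrow> (nat \<Rightarrow> int) \<Rightarrow> (nat \<Rightarrow>\<^sub>0 int) \<Rightarrow> int" where
  "weight r g h = (\<Sum>i<r. g i * Poly_Mapping.lookup h i)"

lemma weight_0 [simp]: "weight r g 0 = 0"
  by (simp add: weight_def)

lemma weight_add: "weight r g (h + k) = weight r g h + weight r g k"
  by (simp add: weight_def lookup_add distrib_left sum.distrib)

text \<open>A semifield homomorphism to the integers with minimum and addition. Only values on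
  \<open>S\<close> are constrained, so the notion is shared by all charts with the same
  subtraction-free elements.\<close>

definition tropical :: "'f::field_char_0 set \<Rightarrow> ('f \<Rightarrow> int) \<Rightarrow> bool" where
  "tropical S v \<longleftrightarrow> (\<forall>a\<in>S. \<forall>b\<in>S. v (a * b) = v a + v b \<and> v (a + b) = min (v a) (v b))"

lemma tropical_mult: "tropical S v \<Longrightarrow> a \<in> S \<Longrightarrow> b \<in> S \<Longrightarrow> v (a * b) = v a + v b"
  by (simp add: tropical_def)

lemma tropical_add: "tropical S v \<Longrightarrow> a \<in> S \<Longrightarrow> b \<in> S \<Longrightarrow> v (a + b) = min (v a) (v b)"
  by (simp add: tropical_def)

text \<open>The monomial valuation with value \<open>g i\<close> at \<open>z i\<close>. A field
  element has many representations as a quotient; \<open>val_quotient\<close> shows that the value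
  does not depend on the choice, which justifies \<open>THE\<close>.\<close>

definition val :: "nat \<Rightarrow> (nat \<Rightarrow> 'f::field_char_0) \<Rightarrow> (nat \<Rightarrow> int) \<Rightarrow> 'f \<Rightarrow> int" where
  "val r z g x = (THE n. \<exists>p\<in>laurents r. \<exists>q\<in>laurents r. p \<noteq> 0 \<and> q \<noteq> 0 \<and>
     x = laurent_eval r z p / laurent_eval r z q \<and> n = lowest (weight r g) p - lowest (weight r g) q)"

section \<open>Subtraction-free elements in a single chart\<close>

locale chart =
  fixes r :: nat and z :: "nat \<Rightarrow> 'f::field_char_0"
  assumes independent: "algebraically_independent r z"
begin

lemma generator_nonzero:
  assumes "i < r"
  shows "z i \<noteq> 0"
proof
  assume "z i = 0"
  let ?p = "Poly_Mapping.single (Poly_Mapping.single i 1) 1 :: (nat \<Rightarrow>\<^sub>0 nat) \<Rightarrow>\<^sub>0 rat"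
  have "(\<Prod>j<r. z j ^ Poly_Mapping.lookup (Poly_Mapping.single i 1) j) = 0"
    by (rule prod_zero[OF _ bexI[of _ i]]) (simp_all add: \<open>z i = 0\<close> assms)
  then have "poly_eval r z ?p = 0"
    by (simp add: poly_eval_def)
  moreover have "?p \<in> polys r"
    using assms by (simp add: polys_def exponents_def)
  ultimately have "?p = 0"
    using independent by (simp add: algebraically_independent_def)
  then show False
    by (metis lookup_single_eq lookup_zero zero_neq_one)
qed

lemma eval_mult: "laurent_eval r z (p * q) = laurent_eval r z p * laurent_eval r z q"
  by (rule laurent_eval_mult) (rule generator_nonzero)

text \<open>Clearing denominators turns a Laurent relation into a polynomial one, which algebraic
  independence forbids. Laurent expansions in a chart are therefore unique.\<close>

lemma eval_eq_0_iff:
  assumes "p \<in> laurents r"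
  shows "laurent_eval r z p = 0 \<longleftrightarrow> p = 0"
proof
  assume p0: "laurent_eval r z p = 0"
  obtain q where "q \<in> polys r" "poly_eval r z q = 0" "q = 0 \<longleftrightarrow> p = 0"
    using clear_denominators[where z = z, OF assms generator_nonzero] p0
    by (metis mult_zero_right order_refl)
  then show "p = 0"
    using independent by (simp add: algebraically_independent_def)
qed simp

lemma eval_eq_iff:
  assumes "p \<in> laurents r" "q \<in> laurents r"
  shows "laurent_eval r z p = laurent_eval r z q \<longleftrightarrow> p = q"
proof
  assume eq: "laurent_eval r z p = laurent_eval r z q"
  have "p - q \<in> laurents r"
    using assms keys_diff[of p q] by (auto simp: laurents_def)
  moreover have "laurent_eval r z (p - q) = 0"
    using eq laurent_eval_add[of r z "p - q" q] by simp
  ultimately show "p = q"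
    using eval_eq_0_iff by auto
qed simp

lemma nonneg_eval_nonzero: "p \<in> nonneg_laurents r \<Longrightarrow> laurent_eval r z p \<noteq> 0"
  by (simp add: nonneg_laurents_def eval_eq_0_iff)

text \<open>Laurent numerators and denominators give the same set, since a common power of the
  product of the generators can be cancelled. In this form monomials with negative exponents are
  visibly subtraction-free.\<close>

lemma subtraction_free_eq:
  "subtraction_free r z =
    {laurent_eval r z p / laurent_eval r z q | p q. p \<in> nonneg_laurents r \<and> q \<in> nonneg_laurents r}"
proof -
  have *: "\<exists>q\<in>nonneg_laurents r. laurent_eval r z q = F"
    if F: "F \<in> nonneg_polys r z" "F \<noteq> 0" for F
  proof -
    obtain p where p: "F = poly_eval r z p" "p \<in> polys r" "\<forall>m. Poly_Mapping.lookup p m \<in> \<nat>"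
      using F(1) by (auto simp: nonneg_polys_def)
    have "p \<noteq> 0"
      using p(1) F(2) by (auto simp: poly_eval_def)
    with p show ?thesis
      using poly_eval_eq_laurent_eval[OF p(2), of z] unfolding nonneg_laurents_def
      by (smt (verit) mem_Collect_eq)
  qed
  have "x \<in> subtraction_free r z" if x: "x = laurent_eval r z p / laurent_eval r z q"
    and p: "p \<in> nonneg_laurents r" and q: "q \<in> nonneg_laurents r" for x p q
  proof -
    let ?Z = "\<Prod>i<r. z i"
    have Z: "?Z \<noteq> 0"
      using generator_nonzero by simp
    have clear: "\<exists>N. \<forall>M\<ge>N. ?Z ^ M * laurent_eval r z s \<in> nonneg_polys r z"
      if s: "s \<in> nonneg_laurents r" for s
    proof -
      have sl: "s \<in> laurents r" and sn: "\<forall>h. Poly_Mapping.lookup s h \<in> \<nat>"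
        using s by (auto simp: nonneg_laurents_def)
      show ?thesis
        using clear_denominators[where z = z, OF sl generator_nonzero] sn
        unfolding nonneg_polys_def by (smt (verit) mem_Collect_eq)
    qed
    obtain N1 N2 where N: "\<forall>M\<ge>N1. ?Z ^ M * laurent_eval r z p \<in> nonneg_polys r z"
      "\<forall>M\<ge>N2. ?Z ^ M * laurent_eval r z q \<in> nonneg_polys r z"
      using clear[OF p] clear[OF q] by blast
    \<comment> \<open>One power that clears both numerator and denominator.\<close>
    let ?M = "max N1 N2"
    have "x = (?Z ^ ?M * laurent_eval r z p) / (?Z ^ ?M * laurent_eval r z q)"
      using Z x by simp
    moreover have "?Z ^ ?M * laurent_eval r z p \<noteq> 0" "?Z ^ ?M * laurent_eval r z q \<noteq> 0"
      using Z nonneg_eval_nonzero p q by auto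
    ultimately show ?thesis
      unfolding subtraction_free_def using N by (smt (verit) max.cobounded1 max.cobounded2 mem_Collect_eq)
  qed
  then show ?thesis
    unfolding subtraction_free_def using * by (auto; metis)
qed

abbreviation "S \<equiv> subtraction_free r z"

lemma sf_cases:
  assumes "x \<in> S"
  obtains p q where "p \<in> nonneg_laurents r" "q \<in> nonneg_laurents r"
    "x = laurent_eval r z p / laurent_eval r z q"
  using assms unfolding subtraction_free_eq by auto

lemma sf_divide: "p \<in> nonneg_laurents r \<Longrightarrow> q \<in> nonneg_laurents r \<Longrightarrow>
    laurent_eval r z p / laurent_eval r z q \<in> S"
  unfolding subtraction_free_eq by blast

lemma eval_nonneg_in_sf: "p \<in> nonneg_laurents r \<Longrightarrow> laurent_eval r z p \<in> S"
  unfolding subtraction_free_eq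
  using nonneg_laurents_single[of 0 r] by (force simp: exponents_def)

lemma monomial_in_sf: "h \<in> exponents r \<Longrightarrow> laurent_monomial r z h \<in> S"
  using eval_nonneg_in_sf[OF nonneg_laurents_single] by (simp add: laurent_eval_single)

lemma sf_nonzero: "x \<in> S \<Longrightarrow> x \<noteq> 0"
  using nonneg_eval_nonzero by (auto elim!: sf_cases)

lemma sf_one: "1 \<in> S"
  using monomial_in_sf[of 0] by (simp add: exponents_def)

lemma sf_mult:
  assumes "x \<in> S" "y \<in> S"
  shows "x * y \<in> S"
proof -
  obtain p q where x: "p \<in> nonneg_laurents r" "q \<in> nonneg_laurents r"
    "x = laurent_eval r z p / laurent_eval r z q" using assms sf_cases by blast
  obtain p' q' where y: "p' \<in> nonneg_laurents r" "q' \<in> nonneg_laurents r"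
    "y = laurent_eval r z p' / laurent_eval r z q'" using assms sf_cases by blast
  have "x * y = laurent_eval r z (p * p') / laurent_eval r z (q * q')"
    by (simp add: x y eval_mult)
  then show ?thesis
    using x y by (simp add: sf_divide nonneg_laurents_mult)
qed

lemma sf_add:
  assumes "x \<in> S" "y \<in> S"
  shows "x + y \<in> S"
proof -
  obtain p q where x: "p \<in> nonneg_laurents r" "q \<in> nonneg_laurents r"
    "x = laurent_eval r z p / laurent_eval r z q" using assms sf_cases by blast
  obtain p' q' where y: "p' \<in> nonneg_laurents r" "q' \<in> nonneg_laurents r"
    "y = laurent_eval r z p' / laurent_eval r z q'" using assms sf_cases by blast
  have "x + y = laurent_eval r z (p * q' + p' * q) / laurent_eval r z (q * q')"
    using x y by (simp add: eval_mult laurent_eval_add nonneg_eval_nonzero add_frac_eq)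
  then show ?thesis
    using x y by (simp add: sf_divide nonneg_laurents_mult nonneg_laurents_add)
qed

lemma sf_inverse: "x \<in> S \<Longrightarrow> inverse x \<in> S"
  unfolding subtraction_free_eq by (force simp: inverse_eq_divide)

section \<open>Monomial valuations as tropical points\<close>

lemma val_quotient:
  assumes "p \<in> laurents r" "q \<in> laurents r" "p \<noteq> 0" "q \<noteq> 0"
  shows "val r z g (laurent_eval r z p / laurent_eval r z q) =
    lowest (weight r g) p - lowest (weight r g) q"
  unfolding val_def
proof (rule the_equality)
  fix n
  assume "\<exists>p'\<in>laurents r. \<exists>q'\<in>laurents r. p' \<noteq> 0 \<and> q' \<noteq> 0 \<and>
    laurent_eval r z p / laurent_eval r z q = laurent_eval r z p' / laurent_eval r z q' \<and>
    n = lowest (weight r g) p' - lowest (weight r g) q'"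
  then obtain p' q' where pq': "p' \<in> laurents r" "q' \<in> laurents r" "p' \<noteq> 0" "q' \<noteq> 0"
    "laurent_eval r z p / laurent_eval r z q = laurent_eval r z p' / laurent_eval r z q'"
    "n = lowest (weight r g) p' - lowest (weight r g) q'" by blast
  \<comment> \<open>Two quotients for one element are cross-multiplied; uniqueness of expansions
    makes this an identity of Laurent polynomials, to which additivity of lowest weights
    applies.\<close>
  have "laurent_eval r z (p * q') = laurent_eval r z (p' * q)"
    using pq' assms by (simp add: eval_mult eval_eq_0_iff frac_eq_eq)
  then have "p * q' = p' * q"
    using eval_eq_iff pq' assms laurents_mult by blast
  then have "lowest (weight r g) p + lowest (weight r g) q' = lowest (weight r g) p' + lowest (weight r g) q"
    using assms pq' by (metis lowest_mult weight_add)
  then show "n = lowest (weight r g) p - lowest (weight r g) q"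
    using pq'(6) by simp
qed (use assms in blast)

lemma val_monomial:
  assumes "h \<in> exponents r"
  shows "val r z g (laurent_monomial r z h) = weight r g h"
proof -
  let ?p = "Poly_Mapping.single h 1 :: (nat \<Rightarrow>\<^sub>0 int) \<Rightarrow>\<^sub>0 rat"
  let ?one = "Poly_Mapping.single 0 1 :: (nat \<Rightarrow>\<^sub>0 int) \<Rightarrow>\<^sub>0 rat"
  have nn: "?p \<in> nonneg_laurents r" "?one \<in> nonneg_laurents r"
    using assms by (intro nonneg_laurents_single; simp add: exponents_def)+
  then have "val r z g (laurent_eval r z ?p / laurent_eval r z ?one) =
      lowest (weight r g) ?p - lowest (weight r g) ?one"
    by (intro val_quotient) (auto simp: nonneg_laurents_def)
  then show ?thesis
    by (simp add: laurent_eval_single lowest_def)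
qed

lemma lowest_add_nonneg:
  assumes "p \<in> nonneg_laurents r" "q \<in> nonneg_laurents r"
  shows "lowest w (p + q) = min (lowest w p) (lowest w q)"
proof -
  have "p \<noteq> 0" "q \<noteq> 0"
    using assms by (auto simp: nonneg_laurents_def)
  then show ?thesis
    unfolding lowest_def keys_add_nonneg_laurents[OF assms] image_Un by (intro Min_Un) auto
qed

text \<open>Each integer vector \<open>g\<close> thus gives a tropical point. The rule for sums
  holds because, over a common denominator, the two numerators have nonnegative coefficients and
  cannot cancel.\<close>

lemma tropical_val: "tropical S (val r z g)"
  unfolding tropical_def
proof (intro ballI)
  fix x y assume "x \<in> S" "y \<in> S"
  then obtain p q p' q' where x: "p \<in> nonneg_laurents r" "q \<in> nonneg_laurents r"
      "x = laurent_eval r z p / laurent_eval r z q"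
    and y: "p' \<in> nonneg_laurents r" "q' \<in> nonneg_laurents r"
      "y = laurent_eval r z p' / laurent_eval r z q'"
    using sf_cases by metis
  have val: "val r z g (laurent_eval r z a / laurent_eval r z b) =
      lowest (weight r g) a - lowest (weight r g) b"
    if "a \<in> nonneg_laurents r" "b \<in> nonneg_laurents r" for a b
    using that by (intro val_quotient) (auto simp: nonneg_laurents_def)
  have low: "lowest (weight r g) (a * b) = lowest (weight r g) a + lowest (weight r g) b"
    if "a \<in> nonneg_laurents r" "b \<in> nonneg_laurents r" for a b
    using that by (intro lowest_mult weight_add) (auto simp: nonneg_laurents_def)
  have "x * y = laurent_eval r z (p * p') / laurent_eval r z (q * q')"
    by (simp add: x y eval_mult)
  moreover have "x + y = laurent_eval r z (p * q' + p' * q) / laurent_eval r z (q * q')"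
    using x y by (simp add: eval_mult laurent_eval_add nonneg_eval_nonzero add_frac_eq)
  ultimately show "val r z g (x * y) = val r z g x + val r z g y \<and>
      val r z g (x + y) = min (val r z g x) (val r z g y)"
    using x y by (simp add: val low nonneg_laurents_mult nonneg_laurents_add lowest_add_nonneg
        min_diff_distrib_left)
qed

section \<open>Values of arbitrary tropical points\<close>

lemma tropical_one: "tropical S v \<Longrightarrow> v 1 = 0"
  using tropical_mult[of S v 1 1] sf_one by simp

lemma tropical_divide:
  assumes v: "tropical S v" and "x \<in> S" "y \<in> S"
  shows "v (x / y) = v x - v y"
proof -
  have "x / y \<in> S"
    using assms sf_mult sf_inverse by (simp add: divide_inverse)
  then have "v (x / y * y) = v (x / y) + v y"
    using assms tropical_mult by blast
  then show ?thesis
    using sf_nonzero assms by simp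
qed

lemma sf_of_nat: "0 < n \<Longrightarrow> of_nat n \<in> S"
  by (induction n rule: nat_induct_non_zero) (use sf_one sf_add in simp_all)

text \<open>A sum of ones has value \<open>min 0 0\<close>; positive integer coefficients are
  invisible to tropical points.\<close>

lemma tropical_of_nat:
  assumes v: "tropical S v"
  shows "0 < n \<Longrightarrow> v (of_nat n) = 0"
proof (induction n rule: nat_induct_non_zero)
  case (Suc n)
  then show ?case
    using tropical_add[OF v sf_one sf_of_nat[of n]] tropical_one[OF v] by simp
qed (use tropical_one[OF v] in simp)

lemma tropical_power:
  assumes v: "tropical S v" and x: "x \<in> S"
  shows "x ^ n \<in> S \<and> v (x ^ n) = int n * v x"
  by (induction n)
    (use x in \<open>simp_all add: sf_one tropical_one[OF v] sf_mult tropical_mult[OF v] distrib_right\<close>)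

lemma tropical_power_int:
  assumes v: "tropical S v" and x: "x \<in> S"
  shows "x powi n \<in> S \<and> v (x powi n) = n * v x"
proof (cases "0 \<le> n")
  case True
  then show ?thesis
    using tropical_power[OF assms, of "nat n"] by (simp add: power_int_def)
next
  case False
  have "v (inverse x) = - v x"
    using tropical_divide[OF v sf_one x] tropical_one[OF v] by (simp add: inverse_eq_divide)
  then show ?thesis
    using False tropical_power[OF v sf_inverse[OF x], of "nat (- n)"]
    by (simp add: power_int_def power_inverse)
qed

lemma generator_in_sf:
  assumes "i < r"
  shows "z i \<in> S"
proof -
  have "laurent_monomial r z (Poly_Mapping.single i 1) = (\<Prod>j<r. if j = i then z i else 1)"
    unfolding laurent_monomial_def
    by (intro prod.cong refl) (auto simp: lookup_single when_def)
  also have "\<dots> = z i"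
    using assms by (simp add: prod.delta)
  finally show ?thesis
    using monomial_in_sf[of "Poly_Mapping.single i 1"] assms by (simp add: exponents_def)
qed

lemma tropical_monomial:
  assumes v: "tropical S v"
  shows "v (laurent_monomial r z h) = weight r (\<lambda>i. v (z i)) h"
proof -
  \<comment> \<open>Membership in \<open>S\<close> is carried through the induction because the
    product rule for \<open>v\<close> holds only there.\<close>
  have "n \<le> r \<Longrightarrow> (\<Prod>i<n. z i powi Poly_Mapping.lookup h i) \<in> S \<and>
      v (\<Prod>i<n. z i powi Poly_Mapping.lookup h i) = (\<Sum>i<n. v (z i) * Poly_Mapping.lookup h i)" for n
  proof (induction n)
    case (Suc n)
    then show ?case
      using tropical_power_int[OF v generator_in_sf[of n], of "Poly_Mapping.lookup h n"]
      by (simp add: sf_mult tropical_mult[OF v])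
  qed (simp add: sf_one tropical_one[OF v])
  then show ?thesis
    by (simp add: laurent_monomial_def weight_def)
qed

text \<open>Coefficients contribute 0 and sums become minima, so on nonnegative Laurent polynomials
  any tropical point is determined by its values at the generators.\<close>

lemma tropical_eval_nonneg:
  assumes v: "tropical S v" and p: "p \<in> nonneg_laurents r"
  shows "v (laurent_eval r z p) = lowest (weight r (\<lambda>i. v (z i))) p"
proof -
  let ?w = "weight r (\<lambda>i. v (z i))"
  let ?f = "\<lambda>h. of_rat (Poly_Mapping.lookup p h) * laurent_monomial r z h"
  have term_sf: "?f h \<in> S \<and> v (?f h) = ?w h" if h: "h \<in> Poly_Mapping.keys p" for h
  proof -
    obtain n where n: "Poly_Mapping.lookup p h = of_nat n"
      using p by (auto simp: nonneg_laurents_def elim: Nats_cases)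
    then have "0 < n"
      using h by (auto simp: in_keys_iff)
    moreover have "laurent_monomial r z h \<in> S"
      using p h by (intro monomial_in_sf) (auto simp: nonneg_laurents_def laurents_def)
    ultimately show ?thesis
      using n sf_of_nat sf_mult
      by (simp add: tropical_mult[OF v] tropical_of_nat[OF v] tropical_monomial[OF v])
  qed
  \<comment> \<open>The induction runs over nonempty sets, since the empty sum 0 does not lie in
    \<open>S\<close>.\<close>
  have "A \<subseteq> Poly_Mapping.keys p \<Longrightarrow> sum ?f A \<in> S \<and> v (sum ?f A) = Min (?w ` A)"
    if "finite A" "A \<noteq> {}" for A
    using that
  proof (induction A rule: finite_ne_induct)
    case (insert a A)
    then show ?case
      using term_sf[of a] by (simp add: sf_add tropical_add[OF v])
  qed (use term_sf in simp)
  from this[of "Poly_Mapping.keys p"] p show ?thesis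
    by (simp add: laurent_eval_def lowest_def nonneg_laurents_def)
qed

text \<open>The extreme terms of F and of a denominator H cannot cancel in F H, so the support of the
  Laurent expansion of F lies in the half space that the tropical point determines, even if some
  coefficients are negative.\<close>

lemma tropical_le_monomial:
  assumes v: "tropical S v" and p: "p \<in> laurents r" and x: "laurent_eval r z p \<in> S"
    and h: "h \<in> Poly_Mapping.keys p"
  shows "v (laurent_eval r z p) \<le> v (laurent_monomial r z h)"
proof -
  let ?w = "weight r (\<lambda>i. v (z i))"
  obtain a b where ab: "a \<in> nonneg_laurents r" "b \<in> nonneg_laurents r"
    "laurent_eval r z p = laurent_eval r z a / laurent_eval r z b"
    using x sf_cases by blast
  have b: "b \<in> laurents r" "b \<noteq> 0" and a: "a \<in> laurents r"
    using ab by (auto simp: nonneg_laurents_def)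
  have "laurent_eval r z (p * b) = laurent_eval r z a"
    using ab nonneg_eval_nonzero by (simp add: eval_mult)
  \<comment> \<open>Uniqueness of expansions lifts the equation from the field to Laurent
    polynomials.\<close>
  then have "p * b = a"
    using eval_eq_iff a b p laurents_mult by blast
  moreover have "p \<noteq> 0"
    using h by auto
  ultimately have "lowest ?w a = lowest ?w p + lowest ?w b"
    using lowest_mult[of ?w p b] b weight_add by blast
  then have "v (laurent_eval r z p) = lowest ?w p"
    using ab tropical_divide[OF v] eval_nonneg_in_sf tropical_eval_nonneg[OF v] by simp
  then show ?thesis
    using lowest_le[OF h, of ?w] tropical_monomial[OF v] by simp
qed

text \<open>Every valuation \<open>val r z g\<close> gives \<open>h\<close> at most the weight of
  any exponent in the support. As \<open>g\<close> ranges over all integer vectors, these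
  inequalities leave only \<open>h\<close> itself.\<close>

lemma support_eq_if_tropically_monomial:
  assumes p: "p \<in> laurents r" and x: "laurent_eval r z p \<in> S" and h: "h \<in> exponents r"
    and eq: "\<And>v. tropical S v \<Longrightarrow> v (laurent_eval r z p) = v (laurent_monomial r z h)"
  shows "Poly_Mapping.keys p \<subseteq> {h}"
proof
  fix k assume k: "k \<in> Poly_Mapping.keys p"
  then have ke: "k \<in> exponents r"
    using p by (auto simp: laurents_def)
  have le: "weight r g h \<le> weight r g k" for g
    using tropical_le_monomial[OF tropical_val p x k, of g] eq[OF tropical_val, of g]
    by (simp add: val_monomial h ke)
  have "Poly_Mapping.lookup k i = Poly_Mapping.lookup h i" for i
  proof (cases "i < r")
    case True
    \<comment> \<open>Weights supported at one coordinate, taken with \<open>c = 1\<close> and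
      \<open>c = -1\<close>, yield both inequalities between the \<open>i\<close>-th
      entries.\<close>
    have "weight r (\<lambda>j. if j = i then c else 0) l = c * Poly_Mapping.lookup l i" for c l
      using True by (simp add: weight_def if_distrib[of "\<lambda>x. x * _"] sum.delta cong: if_cong)
    then show ?thesis
      using le[of "\<lambda>j. if j = i then 1 else 0"] le[of "\<lambda>j. if j = i then - 1 else 0"] by simp
  qed (simp add: exponents_lookup_eq_0[OF h] exponents_lookup_eq_0[OF ke])
  then show "k \<in> {h}"
    by (simp add: poly_mapping_eqI)
qed

text \<open>Integer coefficients are recast as rational ones to match \<open>laurents\<close>; their
  integrality is recorded for the later argument with units of the integers.\<close>

lemma laurent_ring_cases:
  assumes "x \<in> laurent_ring r z"
  obtains p where "p \<in> laurents r" "x = laurent_eval r z p" "\<And>h. Poly_Mapping.lookup p h \<in> \<int>"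
proof -
  obtain p :: "(nat \<Rightarrow>\<^sub>0 int) \<Rightarrow>\<^sub>0 int" where p: "Poly_Mapping.keys p \<subseteq> exponents r"
    "x = (\<Sum>h\<in>Poly_Mapping.keys p. of_int (Poly_Mapping.lookup p h) * laurent_monomial r z h)"
    using assms by (auto simp: laurent_ring_def)
  let ?q = "Poly_Mapping.map of_int p :: (nat \<Rightarrow>\<^sub>0 int) \<Rightarrow>\<^sub>0 rat"
  have lookup: "Poly_Mapping.lookup ?q h = of_int (Poly_Mapping.lookup p h)" for h
    by (simp add: map.rep_eq when_def)
  have keys: "Poly_Mapping.keys ?q = Poly_Mapping.keys p"
    unfolding set_eq_iff in_keys_iff lookup by simp
  show ?thesis
    by (rule that[of ?q]) (use p in \<open>simp_all add: laurents_def keys lookup laurent_eval_def\<close>)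
qed

end

section \<open>Global monomials across the charts of a positive space\<close>

lemma chart_if_positive_space: "positive_space r T z \<Longrightarrow> t \<in> T \<Longrightarrow> chart r (z t)"
  by (simp add: positive_space_def free_generators_def chart_def)

lemma global_monomials_cases:
  assumes "m \<in> global_monomials r T z"
  obtains t h where "t \<in> T" "h \<in> exponents r" "m = laurent_monomial r (z t) h"
  using assms by (auto simp: global_monomials_def)

lemma global_monomial_in_laurent_ring:
  "m \<in> global_monomials r T z \<Longrightarrow> t \<in> T \<Longrightarrow> m \<in> laurent_ring r (z t)"
  by (auto simp: global_monomials_def coordinate_algebra_def)

text \<open>A monomial is subtraction-free in its own chart, and all charts share one set of
  subtraction-free elements.\<close>

lemma global_monomial_in_sf:
  assumes pos: "positive_space r T z" and "t \<in> T" "m \<in> global_monomials r T z"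
  shows "m \<in> subtraction_free r (z t)"
proof -
  obtain s h where s: "s \<in> T" "h \<in> exponents r" "m = laurent_monomial r (z s) h"
    using assms(3) global_monomials_cases by blast
  then have "m \<in> subtraction_free r (z s)"
    using chart.monomial_in_sf[OF chart_if_positive_space[OF pos]] by blast
  then show ?thesis
    using pos assms(2) s(1) unfolding positive_space_def by blast
qed

text \<open>In a chart where \<open>m\<close> is a monomial, the expansion of \<open>m'\<close> has
  its support squeezed to the exponent of \<open>m\<close>; the remaining coefficient is an
  integer.\<close>

lemma tropically_equal_global_monomials_proportional:
  assumes pos: "positive_space r T z" and t0: "t0 \<in> T"
    and m: "m \<in> global_monomials r T z" and m': "m' \<in> global_monomials r T z"
    and eq: "\<And>v. tropical (subtraction_free r (z t0)) v \<Longrightarrow> v m = v m'"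
  obtains c :: int where "m' = of_int c * m"
proof -
  obtain t h where t: "t \<in> T" "h \<in> exponents r" "m = laurent_monomial r (z t) h"
    using m global_monomials_cases by blast
  interpret chart r "z t"
    using chart_if_positive_space[OF pos t(1)] .
  have S: "subtraction_free r (z t0) = S"
    using pos t0 t(1) unfolding positive_space_def by blast
  obtain p where p: "p \<in> laurents r" "m' = laurent_eval r (z t) p" "\<And>h. Poly_Mapping.lookup p h \<in> \<int>"
    using laurent_ring_cases[OF global_monomial_in_laurent_ring[OF m' t(1)]] by blast
  have "v (laurent_eval r (z t) p) = v (laurent_monomial r (z t) h)" if "tropical S v" for v
    using eq[of v] that unfolding S p(2)[symmetric] t(3)[symmetric] by simp
  then have "Poly_Mapping.keys p \<subseteq> {h}"
    using global_monomial_in_sf[OF pos t(1) m'] p(1,2) t(2)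
    by (intro support_eq_if_tropically_monomial) simp_all
  then have "m' = of_rat (Poly_Mapping.lookup p h) * m"
    using laurent_eval_superset[of "{h}" p r "z t"] p t by simp
  moreover obtain c where "Poly_Mapping.lookup p h = of_int c"
    using p(3) Ints_cases by blast
  ultimately show ?thesis
    using that[of c] by simp
qed

text \<open>Proportionality in both directions makes the factor a unit of the integers. The factor
  -1 is impossible, as \<open>m + m'\<close> is subtraction-free and hence nonzero.\<close>

lemma tropically_equal_global_monomials_eq:
  assumes pos: "positive_space r T z" and t0: "t0 \<in> T"
    and m: "m \<in> global_monomials r T z" and m': "m' \<in> global_monomials r T z"
    and eq: "\<And>v. tropical (subtraction_free r (z t0)) v \<Longrightarrow> v m = v m'"
  shows "m = m'"
proof -
  interpret chart r "z t0"
    using chart_if_positive_space[OF pos t0] .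
  have sf: "m \<in> S" "m' \<in> S"
    using global_monomial_in_sf[OF pos t0] m m' by auto
  obtain c where c: "m' = of_int c * m"
    using tropically_equal_global_monomials_proportional[OF pos t0 m m' eq] .
  obtain d where d: "m = of_int d * m'"
    using tropically_equal_global_monomials_proportional[OF pos t0 m' m eq[symmetric]] .
  have "of_int (d * c) * m = 1 * m"
    using c d by (simp add: mult.assoc)
  then have "d * c = 1"
    using sf_nonzero[OF sf(1)] by (metis mult_right_cancel of_int_eq_1_iff)
  moreover have "c \<noteq> -1"
  proof
    assume "c = -1"
    then have "m + m' = 0"
      using c by simp
    then show False
      using sf_nonzero[OF sf_add[OF sf]] by simp
  qed
  ultimately have "c = 1"
    by (metis zmult_eq_1_iff mult.commute)
  then show ?thesis
    using c by simp
qed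

section \<open>Linear independence of global monomials\<close>

theorem theorem1p6:
  fixes r :: nat and T :: "'t set" and z :: "'t \<Rightarrow> nat \<Rightarrow> 'f::field_char_0"
  assumes "positive_space r T z"
  shows "module.independent int_scale (global_monomials r T z)"
proof
  assume "module.dependent int_scale (global_monomials r T z)"
  then obtain A u where A: "finite A" "A \<subseteq> global_monomials r T z"
    "(\<Sum>m\<in>A. int_scale (u m) m) = 0" "\<exists>m\<in>A. u m \<noteq> 0"
    unfolding module.dependent_explicit[OF module_int_scale] by blast
  define B where "B = {m \<in> A. u m \<noteq> 0}"
  have B: "finite B" "B \<subseteq> global_monomials r T z" "B \<noteq> {}"
    using A by (auto simp: B_def)
  have sum_B: "(\<Sum>m\<in>B. of_int (u m) * m) = 0"
  proof -
    have "(\<Sum>m\<in>B. of_int (u m) * m) = (\<Sum>m\<in>A. int_scale (u m) m)"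
      unfolding int_scale_def B_def by (rule sum.mono_neutral_left) (use A in auto)
    then show ?thesis
      using A by simp
  qed
  obtain t0 where t0: "t0 \<in> T"
    using assms by (auto simp: positive_space_def)
  let ?S = "subtraction_free r (z t0)"
  \<comment> \<open>Pointwise comparison at all tropical points is only a preorder on field
    elements, so the minimal element is sought for its strict part \<open>R\<close>. The chart
    \<open>t0\<close> merely names the common set of subtraction-free elements.\<close>
  define le where "le m m' \<longleftrightarrow> (\<forall>v. tropical ?S v \<longrightarrow> v m \<le> v m')" for m m' :: 'f
  define R where "R m m' \<longleftrightarrow> le m m' \<and> \<not> le m' m" for m m' :: 'f
  have "\<exists>m\<in>B. \<forall>x\<in>B. x \<noteq> m \<longrightarrow> \<not> R x m"
  proof (rule Finite_Set.bex_min_element)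
    show "asymp_on B R"
      by (rule asymp_onI) (simp add: R_def)
    show "transp_on B R"
      by (rule transp_onI) (unfold R_def le_def, meson order_trans)
  qed (use B in auto)
  then obtain m where m: "m \<in> B" "\<forall>x\<in>B. x \<noteq> m \<longrightarrow> \<not> R x m" ..
  \<comment> \<open>On global monomials the preorder is antisymmetric, which upgrades minimality:
    nothing in \<open>B\<close> other than \<open>m\<close> lies below \<open>m\<close>.\<close>
  have minimal: "x = m" if x: "x \<in> B" "le x m" for x
  proof (rule ccontr)
    assume "x \<noteq> m"
    then have "le m x"
      using m x by (auto simp: R_def)
    then have "v x = v m" if "tropical ?S v" for v
      using x(2) that unfolding le_def by (meson antisym)
    then have "x = m"
      using tropically_equal_global_monomials_eq[OF assms t0] B m x by blast
    with \<open>x \<noteq> m\<close> show False ..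
  qed
  obtain t h where t: "t \<in> T" "h \<in> exponents r" "m = laurent_monomial r (z t) h"
    using m B global_monomials_cases by blast
  interpret chart r "z t"
    using chart_if_positive_space[OF assms t(1)] .
  have S: "?S = S"
    using assms t0 t(1) unfolding positive_space_def by blast
  have "\<exists>p\<in>laurents r. x = laurent_eval r (z t) p" if "x \<in> B" for x
    using laurent_ring_cases global_monomial_in_laurent_ring[of x r T z t] that B t(1) by blast
  then obtain p where p: "\<And>x. x \<in> B \<Longrightarrow> p x \<in> laurents r"
    "\<And>x. x \<in> B \<Longrightarrow> x = laurent_eval r (z t) (p x)"
    by metis
  \<comment> \<open>If \<open>h\<close> occurred in the expansion of \<open>x\<close>, every
    tropical value of \<open>x\<close> would be at most that of \<open>m\<close>, against
    minimality.\<close>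
  have absent: "h \<notin> Poly_Mapping.keys (p x)" if x: "x \<in> B" "x \<noteq> m" for x
  proof
    assume h: "h \<in> Poly_Mapping.keys (p x)"
    have "x \<in> S"
      using global_monomial_in_sf[OF assms t(1)] x B by blast
    then have "v x \<le> v m" if "tropical ?S v" for v
      using tropical_le_monomial[OF _ p(1)[OF x(1)] _ h, of v] p(2)[OF x(1)] t that S by simp
    then show False
      using minimal x by (simp add: le_def)
  qed
  \<comment> \<open>The expansion \<open>p m\<close> came from a choice; uniqueness identifies
    it.\<close>
  have "p m = Poly_Mapping.single h 1"
    using p[OF m(1)] t laurents_single eval_eq_iff
    by (metis laurent_eval_single mult_1 of_rat_1)
  then have pm: "Poly_Mapping.lookup (p m) h = 1"
    by simp
  \<comment> \<open>The linear relation lifted to Laurent polynomials, with scalars as constant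
    terms. It evaluates to 0, so its coefficient at \<open>h\<close>, which is \<open>u m\<close>,
    must vanish.\<close>
  define q where "q = (\<Sum>x\<in>B. Poly_Mapping.single 0 (of_int (u x)) * p x)"
  have "Poly_Mapping.single 0 (of_int (u x)) * p x \<in> laurents r" if "x \<in> B" for x
    using that p by (intro laurents_mult laurents_single) (auto simp: exponents_def)
  then have "q \<in> laurents r"
    unfolding q_def by (rule laurents_sum)
  moreover have "laurent_eval r (z t) q = 0"
    unfolding q_def laurent_eval_sum eval_mult laurent_eval_single
    using sum_B p(2)[symmetric] by simp
  ultimately have "q = 0"
    using eval_eq_0_iff by blast
  have lookup_scale: "Poly_Mapping.lookup (Poly_Mapping.single 0 c * a) h = c * Poly_Mapping.lookup a h"
    for c and a :: "(nat \<Rightarrow>\<^sub>0 int) \<Rightarrow>\<^sub>0 rat"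
    by (simp add: map.rep_eq when_def flip: mult_map_scale_conv_mult)
  have "Poly_Mapping.lookup q h = (\<Sum>x\<in>B. of_int (u x) * Poly_Mapping.lookup (p x) h)"
    unfolding q_def lookup_sum lookup_scale ..
  then have "0 = (\<Sum>x\<in>B. of_int (u x) * Poly_Mapping.lookup (p x) h)"
    using \<open>q = 0\<close> by simp
  also have "\<dots> = (\<Sum>x\<in>B. if x = m then of_int (u m) else 0)"
    by (intro sum.cong refl) (use absent pm in \<open>auto simp: in_keys_iff\<close>)
  also have "\<dots> = of_int (u m)"
    using B m by simp
  finally show False
    using m by (simp add: B_def)
qed

end
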